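(* Let $a_0,a_1$ be elements of a commutative ring with unity and $x$ an indeterminate. Then for all $n\geqslant1$ and $k\geqslant1$, \[ R\bigl(x;(a_0I_n+a_1P_n)\otimes J_k\bigr)=\sum\Bigl(\prod_{i=1}^n\binom{k}{l_i^{(1)}}\binom{k-l_{i+1}^{(1)}}{l_i^{(2)}}\binom{k}{l_i^{(1)}+l_i^{(2)}}\bigl(l_i^{(1)}+l_i^{(2)}\bigr)!\Bigr)a_0^{\sum_{i=1}^nl_i^{(1)}}a_1^{\sum_{i=1}^nl_i^{(2)}}x^{\sum_{i=1}^n(l_i^{(1)}+l_i^{(2)})}, \] where the sum is over all pairs $(l_1^{(1)},\dots,l_n^{(1)}),(l_1^{(2)},\dots,l_n^{(2)})\in\{0,1,\dots,k\}^n$ with $l_i^{(2)}\leqslant\min(k-l_i^{(1)},k-l_{i+1}^{(1)})$ for $1\le i\le n$, and indices are taken cyclically: $l_{n+1}^{(1)}=l_1^{(1)}$.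
   Context: $P_n=(c_{i,j})_{1\le i,j\le n}$ with $c_{i,j}=1$ if $j-i\equiv1\pmod n$ and $0$ otherwise. $J_k$ is the $k\times k$ all-ones matrix, $\otimes$ the Kronecker product. For an $m\times n$ matrix $A=(a_{i,j})$ with $m\le n$, the rook polynomial is $R(x;A)=1+\sum_{j=1}^mx^j\sum_{S\subseteq\{1..m\},|S|=j}\sum_{\sigma:S\to\{1..n\}\text{ injective}}\prod_{i\in S}a_{i,\sigma(i)}$. *)

theory Defs
  imports
    "HOL-Library.FuncSet"
    "HOL-Number_Theory.Cong"
    "HOL-Computational_Algebra.Polynomial"
    "Jordan_Normal_Form.Matrix"
begin

(* All matrix indices are 0-based, as usual for Jordan_Normal_Form matrices. *)

(* For n = 1 the congruence is trivially true, so cyclic_shift_mat 1 is the 1 x 1 identity. *)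
definition cyclic_shift_mat :: "nat \<Rightarrow> 'a::zero_neq_one mat" where
  "cyclic_shift_mat n =
     mat n n (\<lambda>(i, j). if [int j - int i = 1] (mod int n) then 1 else 0)"

definition all_ones_mat :: "nat \<Rightarrow> 'a::one mat" where
  "all_ones_mat k = mat k k (\<lambda>_. 1)"

definition kronecker :: "'a::times mat \<Rightarrow> 'a mat \<Rightarrow> 'a mat" where
  "kronecker A B = mat (dim_row A * dim_row B) (dim_col A * dim_col B)
     (\<lambda>(i, j). A $$ (i div dim_row B, j div dim_col B) * B $$ (i mod dim_row B, j mod dim_col B))"

(* The rook polynomial R(x; A) as a formal polynomial in x. It is intended for matrices with
   dim_row A \<le> dim_col A. The maps \<sigma> are taken from the extensional function space, so that
   each injection defined on S is counted exactly once. *)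
definition rook_poly :: "'a::comm_semiring_1 mat \<Rightarrow> 'a poly" where
  "rook_poly A = 1 + (\<Sum>j = 1..dim_row A.
     monom (\<Sum>S | S \<subseteq> {0..<dim_row A} \<and> card S = j.
              \<Sum>\<sigma> | \<sigma> \<in> S \<rightarrow>\<^sub>E {0..<dim_col A} \<and> inj_on \<sigma> S.
                \<Prod>i\<in>S. A $$ (i, \<sigma> i)) j)"

end

theory Submission
  imports Defs
begin

text \<open>
  A rook placement is an injection \<open>\<sigma>\<close> from a set of rows; passing to its inverse, it is
  an injection \<open>\<tau>\<close> from a set \<open>U\<close> of columns to the rows. Every entry of the matrix splits
  as \<open>a\<^sub>0 \<delta> + a\<^sub>1 \<delta>'\<close>, so multiplying out the product of the entries amounts to a choice of
  \<open>U = C \<union> D\<close>, where the columns in \<open>C\<close> are served by their own row block and those in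
  \<open>D\<close> by the preceding one. With \<open>C\<close> and \<open>D\<close> fixed, the row block of every \<open>\<tau> j\<close> is
  determined, and \<open>\<tau>\<close> is an independent choice of an injection into each row block. Finally
  the pairs \<open>(C, D)\<close> are grouped by the numbers of columns served by each row block; \<open>C\<close> is
  chosen first, and \<open>D\<close> then avoids it.
\<close>

section \<open>Counting injections and subsets fibre by fibre\<close>

text \<open>Turns the falling factorial produced by \<open>card_inj_on_subset_funcset\<close> into
  the factors of the final formula. For \<open>m > n\<close> both sides vanish, the product because
  it contains \<open>n - n\<close>.\<close>

lemma prod_minus_eq_binomial_fact:
  "prod ((-) n) {0..<m} = (n choose m) * fact m" for n m :: nat
proof (induction m)
  case (Suc m)
  have "(n choose Suc m) * Suc m = (n choose m) * (n - m)"
    by (metis binomial_absorb_comp binomial_absorption mult.commute)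
  then have "(n choose Suc m) * (Suc m * fact m) = (n choose m) * fact m * (n - m)"
    by (metis (no_types, lifting) mult.assoc mult.commute)
  then show ?case
    using Suc by simp
qed simp

lemma finite_injections:
  "finite A \<Longrightarrow> finite B \<Longrightarrow> finite {f. f \<in> A \<rightarrow>\<^sub>E B \<and> inj_on f A}"
  by (rule finite_subset[of _ "A \<rightarrow>\<^sub>E B"]) (auto intro: finite_PiE)

lemma card_injections:
  assumes "finite A" "finite B"
  shows "card {f \<in> A \<rightarrow>\<^sub>E B. inj_on f A} = (card B choose card A) * fact (card A)"
  using card_inj_on_subset_funcset[OF assms subset_refl]
  by (simp add: prod_minus_eq_binomial_fact)

text \<open>Once the class of \<open>f x\<close> is prescribed, values from different fibres of
  \<open>b\<close> cannot collide, so injectivity only matters inside each fibre. Restricting and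
  gluing then identify \<open>f\<close> with an independent choice of one injection per
  class.\<close>

lemma card_fibrewise_injections:
  fixes g :: "'b \<Rightarrow> 'i" and b :: "'a \<Rightarrow> 'i"
  assumes "finite I" and bI: "b ` A \<subseteq> I"
  shows "card {f \<in> A \<rightarrow>\<^sub>E B. inj_on f A \<and> (\<forall>x\<in>A. g (f x) = b x)} =
    (\<Prod>i\<in>I. card {f \<in> {x \<in> A. b x = i} \<rightarrow>\<^sub>E {y \<in> B. g y = i}. inj_on f {x \<in> A. b x = i}})"
proof -
  define L where "L = {f \<in> A \<rightarrow>\<^sub>E B. inj_on f A \<and> (\<forall>x\<in>A. g (f x) = b x)}"
  define fib where "fib i = {x \<in> A. b x = i}" for i
  define R where "R i = {f \<in> fib i \<rightarrow>\<^sub>E {y \<in> B. g y = i}. inj_on f (fib i)}" for i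
  have R_D: "h i \<in> fib i \<rightarrow>\<^sub>E {y \<in> B. g y = i}" "inj_on (h i) (fib i)"
    if "h \<in> PiE I R" "i \<in> I" for h i
    using PiE_mem[OF that] by (auto simp: R_def)
  define split where "split f = (\<lambda>i\<in>I. restrict f (fib i))" for f :: "'a \<Rightarrow> 'b"
  define glue where "glue h = (\<lambda>x\<in>A. h (b x) x)" for h :: "'i \<Rightarrow> 'a \<Rightarrow> 'b"
  have split_mem: "split f \<in> PiE I R" if "f \<in> L" for f
  proof -
    have "restrict f (fib i) \<in> R i" for i
    proof -
      have "inj_on f (fib i)" using that by (auto simp: L_def fib_def intro: inj_on_subset)
      then have "inj_on (restrict f (fib i)) (fib i)" by simp
      moreover have "restrict f (fib i) \<in> fib i \<rightarrow>\<^sub>E {y \<in> B. g y = i}"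
        using that by (intro PiE_I) (auto simp: L_def fib_def)
      ultimately show ?thesis by (simp add: R_def)
    qed
    then show ?thesis by (simp add: split_def)
  qed
  have glue_mem: "glue h \<in> L" if h: "h \<in> PiE I R" for h
  proof -
    have *: "glue h x \<in> B" "g (glue h x) = b x" if "x \<in> A" for x
      using PiE_mem[OF R_D(1)[OF h, of "b x"], of x] that bI by (auto simp: fib_def glue_def)
    have "inj_on (glue h) A"
    proof (rule inj_onI)
      fix x y assume xy: "x \<in> A" "y \<in> A" "glue h x = glue h y"
      then have bxy: "b x = b y" using * by metis
      then have "h (b x) x = h (b x) y" using xy by (simp add: glue_def)
      moreover have "inj_on (h (b x)) (fib (b x))" using R_D(2)[OF h] xy(1) bI by blast
      ultimately show "x = y" using xy(1,2) bxy by (auto simp: fib_def dest: inj_onD)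
    qed
    moreover have "glue h \<in> A \<rightarrow>\<^sub>E B"
      by (intro PiE_I *) (simp_all add: glue_def)
    ultimately show ?thesis using *(2) by (simp add: L_def)
  qed
  have glue_split: "glue (split f) = f" if "f \<in> L" for f
  proof
    fix x
    show "glue (split f) x = f x"
    proof (cases "x \<in> A")
      case True
      then show ?thesis using bI by (auto simp: glue_def split_def fib_def)
    next
      case False
      have "f \<in> A \<rightarrow>\<^sub>E B" using that by (simp add: L_def)
      then have "f x = undefined" using False by (rule PiE_arb)
      then show ?thesis using False by (simp add: glue_def)
    qed
  qed
  have split_glue: "split (glue h) = h" if h: "h \<in> PiE I R" for h
  proof
    fix i
    show "split (glue h) i = h i"
    proof (cases "i \<in> I")
      case True
      show ?thesis
      proof
        fix x
        show "split (glue h) i x = h i x"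
        proof (cases "x \<in> fib i")
          case x: True
          then have "x \<in> A" "b x = i" by (simp_all add: fib_def)
          then show ?thesis using x True by (simp add: split_def glue_def)
        next
          case x: False
          have "h i x = undefined" using R_D(1)[OF h True] x by (rule PiE_arb)
          then show ?thesis using x True by (simp add: split_def)
        qed
      qed
    next
      case False
      then show ?thesis using PiE_arb[OF h False] by (simp add: split_def)
    qed
  qed
  have "bij_betw split L (PiE I R)"
    by (rule bij_betwI[where g = glue]) (simp_all add: split_mem glue_mem glue_split split_glue)
  then have "card L = card (PiE I R)"
    by (rule bij_betw_same_card)
  then have "card L = (\<Prod>i\<in>I. card (R i))"
    by (simp add: card_PiE[OF \<open>finite I\<close>])
  then show ?thesis
    by (simp add: L_def R_def fib_def)
qed

text \<open>A subset of \<open>A\<close> amounts to a free choice of a subset in each fibre of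
  \<open>b\<close>, so the size conditions decouple.\<close>

lemma card_subsets_with_fibre_cards:
  fixes b :: "'a \<Rightarrow> 'i"
  assumes "finite I" "finite A" and bI: "b ` A \<subseteq> I"
  shows "card {X \<in> Pow A. \<forall>i\<in>I. card {x \<in> X. b x = i} = l i} =
    (\<Prod>i\<in>I. card {x \<in> A. b x = i} choose l i)" (is "card ?L = _")
proof -
  let ?R = "\<lambda>i. {Y. Y \<subseteq> {x \<in> A. b x = i} \<and> card Y = l i}"
  have "bij_betw (\<lambda>X. \<lambda>i\<in>I. {x \<in> X. b x = i}) ?L (PiE I ?R)"
  proof (rule bij_betwI[where g = "\<lambda>h. {x \<in> A. x \<in> h (b x)}"])
    show "(\<lambda>X. \<lambda>i\<in>I. {x \<in> X. b x = i}) \<in> ?L \<rightarrow> PiE I ?R"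
      by auto
    have *: "{x \<in> {x \<in> A. x \<in> h (b x)}. b x = i} = h i" if "h \<in> PiE I ?R" "i \<in> I" for h i
      using PiE_mem[OF that] by auto
    show "(\<lambda>h. {x \<in> A. x \<in> h (b x)}) \<in> PiE I ?R \<rightarrow> ?L"
    proof
      fix h assume h: "h \<in> PiE I ?R"
      have "card (h i) = l i" if "i \<in> I" for i using PiE_mem[OF h that] by blast
      then show "{x \<in> A. x \<in> h (b x)} \<in> ?L" using *[OF h] by simp
    qed
    show "{x \<in> A. x \<in> (\<lambda>i\<in>I. {x \<in> X. b x = i}) (b x)} = X" if "X \<in> ?L" for X
      using that bI by auto
    show "(\<lambda>i\<in>I. {x \<in> {x \<in> A. x \<in> h (b x)}. b x = i}) = h" if h: "h \<in> PiE I ?R" for h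
    proof
      fix i
      show "(\<lambda>i\<in>I. {x \<in> {x \<in> A. x \<in> h (b x)}. b x = i}) i = h i"
        using *[OF h, of i] PiE_arb[OF h, of i] by (cases "i \<in> I") simp_all
    qed
  qed
  then have "card ?L = card (PiE I ?R)"
    by (rule bij_betw_same_card)
  then have "card ?L = (\<Prod>i\<in>I. card (?R i))"
    by (simp only: card_PiE[OF \<open>finite I\<close>])
  then show ?thesis
    using \<open>finite A\<close> by (simp add: n_subsets)
qed

section \<open>The rook polynomial as a sum over placements\<close>

lemma rook_poly_eq_sum:
  fixes A :: "'a::comm_semiring_1 mat"
  shows "rook_poly A = (\<Sum>S\<in>Pow {0..<dim_row A}.
    \<Sum>\<sigma> | \<sigma> \<in> S \<rightarrow>\<^sub>E {0..<dim_col A} \<and> inj_on \<sigma> S. monom (\<Prod>i\<in>S. A $$ (i, \<sigma> i)) (card S))"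
proof -
  let ?f = "\<lambda>S. \<Sum>\<sigma> | \<sigma> \<in> S \<rightarrow>\<^sub>E {0..<dim_col A} \<and> inj_on \<sigma> S. \<Prod>i\<in>S. A $$ (i, \<sigma> i)"
  let ?P = "Pow {0..<dim_row A}"
  have "card ` ?P \<subseteq> {0..dim_row A}"
    using card_mono[of "{0..<dim_row A}"] by auto
  then have "(\<Sum>S\<in>?P. monom (?f S) (card S)) =
    (\<Sum>j\<in>{0..dim_row A}. \<Sum>S | S \<in> ?P \<and> card S = j. monom (?f S) (card S))"
    by (subst sum.group[symmetric, where T = "{0..dim_row A}" and g = card]) auto
  also have "\<dots> = (\<Sum>j\<in>{0..dim_row A}. monom (\<Sum>S | S \<in> ?P \<and> card S = j. ?f S) j)"
    by (intro sum.cong refl) (simp add: monom_sum)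
  also have "\<dots> = monom (\<Sum>S | S \<in> ?P \<and> card S = 0. ?f S) 0
      + (\<Sum>j = 1..dim_row A. monom (\<Sum>S | S \<in> ?P \<and> card S = j. ?f S) j)"
    by (simp add: sum.atLeast_Suc_atMost)
  \<comment> \<open>Finiteness rules out infinite sets, whose \<open>card\<close> is 0 as well. The
    empty set carries exactly one extensional function, with empty product 1; this is the leading 1
    of \<open>rook_poly\<close>.\<close>
  also have "{S. S \<in> ?P \<and> card S = 0} = {{}}"
    by (auto dest: finite_subset)
  finally show ?thesis
    by (simp add: rook_poly_def monom_sum)
qed

text \<open>Inverting each placement preserves its weight and size. The column view suits the final
  formula, where columns are chosen first and rows are then assigned to them.\<close>

lemma rook_poly_eq_sum_columns:
  fixes A :: "'a::comm_semiring_1 mat"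
  shows "rook_poly A = (\<Sum>U\<in>Pow {0..<dim_col A}.
    \<Sum>\<tau> | \<tau> \<in> U \<rightarrow>\<^sub>E {0..<dim_row A} \<and> inj_on \<tau> U. monom (\<Prod>j\<in>U. A $$ (\<tau> j, j)) (card U))"
proof -
  \<comment> \<open>The inverse is cut down to an extensional function, so that inverting twice
    gives back the very same pair.\<close>
  define inv_pl :: "nat set \<times> (nat \<Rightarrow> nat) \<Rightarrow> nat set \<times> (nat \<Rightarrow> nat)"
    where "inv_pl = (\<lambda>(S, \<sigma>). (\<sigma> ` S, \<lambda>j\<in>\<sigma> ` S. inv_into S \<sigma> j))"
  \<comment> \<open>Both sizes are parameters: inversion maps \<open>Pl m n\<close> to
    \<open>Pl n m\<close>, and the same facts then serve both directions.\<close>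
  define Pl where "Pl m n = Sigma (Pow {0..<m}) (\<lambda>S. {\<sigma>. \<sigma> \<in> S \<rightarrow>\<^sub>E {0..<n} \<and> inj_on \<sigma> S})"
    for m n :: nat
  have inv_mem: "inv_pl p \<in> Pl n m" if "p \<in> Pl m n" for p m n
  proof -
    obtain S \<sigma> where p: "p = (S, \<sigma>)" by force
    with that have S: "S \<subseteq> {0..<m}" "\<sigma> \<in> S \<rightarrow>\<^sub>E {0..<n}" "inj_on \<sigma> S" by (auto simp: Pl_def)
    have "inj_on (\<lambda>j\<in>\<sigma> ` S. inv_into S \<sigma> j) (\<sigma> ` S)"
      using inj_on_inv_into[of "\<sigma> ` S" \<sigma> S] by (simp add: inj_on_def)
    then show ?thesis using S unfolding p inv_pl_def Pl_def
      by (auto simp: inv_into_f_f)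
  qed
  have inv_inv: "inv_pl (inv_pl p) = p" if "p \<in> Pl m n" for p m n
  proof -
    obtain S \<sigma> where p: "p = (S, \<sigma>)" by force
    with that have S: "S \<subseteq> {0..<m}" "\<sigma> \<in> S \<rightarrow>\<^sub>E {0..<n}" "inj_on \<sigma> S" by (auto simp: Pl_def)
    let ?t = "\<lambda>j\<in>\<sigma> ` S. inv_into S \<sigma> j"
    have im: "?t ` \<sigma> ` S = S" using S by (auto simp: image_image)
    have "inv_into (\<sigma> ` S) ?t x = \<sigma> x" if "x \<in> S" for x
      by (rule inv_into_f_eq)
         (use that S inj_on_inv_into[of "\<sigma> ` S" \<sigma> S] in \<open>auto simp: inj_on_def\<close>)
    then show ?thesis using S(2,3) unfolding p inv_pl_def
      by (simp add: im) (auto simp: fun_eq_iff PiE_def extensional_def)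
  qed
  have wt: "(\<Prod>j\<in>fst (inv_pl p). A $$ (snd (inv_pl p) j, j)) = (\<Prod>i\<in>fst p. A $$ (i, snd p i))"
      "card (fst (inv_pl p)) = card (fst p)" if "p \<in> Pl m n" for p m n
    using that by (auto simp: Pl_def inv_pl_def prod.reindex card_image)
  have "rook_poly A = (\<Sum>p\<in>Pl (dim_row A) (dim_col A).
      monom (\<Prod>i\<in>fst p. A $$ (i, snd p i)) (card (fst p)))"
    unfolding rook_poly_eq_sum Pl_def
    by (subst sum.Sigma)
      (auto intro!: finite_injections simp: split_beta finite_subset)
  also have "\<dots> = (\<Sum>p\<in>Pl (dim_col A) (dim_row A).
      monom (\<Prod>j\<in>fst p. A $$ (snd p j, j)) (card (fst p)))"
    by (rule sum.reindex_bij_witness[where i = inv_pl and j = inv_pl])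
       (auto simp: inv_inv wt intro: inv_mem)
  also have "\<dots> = (\<Sum>U\<in>Pow {0..<dim_col A}.
    \<Sum>\<tau> | \<tau> \<in> U \<rightarrow>\<^sub>E {0..<dim_row A} \<and> inj_on \<tau> U. monom (\<Prod>j\<in>U. A $$ (\<tau> j, j)) (card U))"
    unfolding Pl_def
    by (subst sum.Sigma)
      (auto intro!: finite_injections simp: split_beta finite_subset)
  finally show ?thesis .
qed


section \<open>Expanding the product of entries\<close>

text \<open>Pairs \<open>C \<subseteq> U\<close> correspond to disjoint pairs via
  \<open>D = U - C\<close>. This lets \<open>C\<close> be chosen first and \<open>D\<close> from
  what is left.\<close>

lemma sum_Pow_split:
  assumes "finite B"
  shows "(\<Sum>U\<in>Pow B. \<Sum>C\<in>Pow U. F C (U - C)) = (\<Sum>C\<in>Pow B. \<Sum>D\<in>Pow (B - C). F C D)"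
proof -
  have "(\<Sum>U\<in>Pow B. \<Sum>C\<in>Pow U. F C (U - C)) = (\<Sum>(U, C)\<in>Sigma (Pow B) Pow. F C (U - C))"
    using assms by (subst sum.Sigma) (auto intro: finite_subset)
  also have "\<dots> = (\<Sum>(C, D)\<in>Sigma (Pow B) (\<lambda>C. Pow (B - C)). F C D)"
    by (rule sum.reindex_bij_witness[where i = "\<lambda>(C, D). (C \<union> D, C)" and j = "\<lambda>(U, C). (C, U - C)"])
       auto
  also have "\<dots> = (\<Sum>C\<in>Pow B. \<Sum>D\<in>Pow (B - C). F C D)"
    using assms by (subst sum.Sigma) (auto intro: finite_subset)
  finally show ?thesis .
qed

lemma prod_if_zero:
  fixes a :: "'a::comm_semiring_1"
  assumes "finite A"
  shows "(\<Prod>x\<in>A. if P x then a else 0) = (if \<forall>x\<in>A. P x then a ^ card A else 0)"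
  using assms by (induction A) auto

text \<open>Multiplying out picks one summand per factor, and \<open>C\<close> records where the
  first is taken. Nothing requires \<open>g j \<noteq> h j\<close>: where they agree, one
  \<open>f\<close> contributes for several \<open>C\<close>, as happens for
  \<open>n = 1\<close>.\<close>

lemma prod_two_indicators:
  fixes a b :: "'a::comm_semiring_1"
  assumes "finite U"
  shows "(\<Prod>j\<in>U. (if f j = g j then a else 0) + (if f j = h j then b else 0)) =
    (\<Sum>C\<in>Pow U. if \<forall>j\<in>U. f j = (if j \<in> C then g j else h j)
      then a ^ card C * b ^ card (U - C) else 0)"
  unfolding prod_add[OF assms]
proof (rule sum.cong[OF refl])
  fix C assume "C \<in> Pow U"
  then have "finite C" "C \<subseteq> U" using assms by (auto intro: finite_subset)
  then show "(\<Prod>j\<in>C. if f j = g j then a else 0) * (\<Prod>j\<in>U - C. if f j = h j then b else 0) =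
    (if \<forall>j\<in>U. f j = (if j \<in> C then g j else h j) then a ^ card C * b ^ card (U - C) else 0)"
    using assms by (auto simp: prod_if_zero)
qed

section \<open>Entries and blocks of the Kronecker product\<close>

text \<open>The cyclic predecessor is written with \<open>+ n\<close> so that the subtraction on
  naturals is not truncated at \<open>j = 0\<close>.\<close>

lemma pred_mod_eq_iff:
  fixes i j n :: nat
  assumes "i < n" "j < n"
  shows "i = (j + n - 1) mod n \<longleftrightarrow> j = (i + 1) mod n"
proof -
  have "(j + n - 1) mod n = (if j = 0 then n - 1 else j - 1)"
  proof (cases "j = 0")
    case False
    then have "j + n - 1 = (j - 1) + n" by simp
    then show ?thesis using assms False by (simp only: mod_add_self2) simp
  qed (use assms in simp)
  moreover have "(i + 1) mod n = (if i = n - 1 then 0 else i + 1)"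
    using assms by auto
  ultimately show ?thesis using assms by auto
qed

lemma cong_diff_one_iff:
  fixes i j n :: nat
  assumes "i < n" "j < n"
  shows "[int j - int i = 1] (mod int n) \<longleftrightarrow> j = (i + 1) mod n"
proof -
  have "[int j - int i = 1] (mod int n) \<longleftrightarrow> [int j = int (i + 1)] (mod int n)"
    by (simp add: cong_iff_dvd_diff algebra_simps)
  also have "\<dots> \<longleftrightarrow> j = (i + 1) mod n"
    unfolding cong_int_iff using assms by (simp add: cong_def)
  finally show ?thesis .
qed

lemma index_kronecker_all_ones:
  assumes "r < dim_row A * k" "c < dim_col A * k"
  shows "kronecker A (all_ones_mat k) $$ (r, c) = (A $$ (r div k, c div k) :: 'a::comm_semiring_1)"
proof -
  \<comment> \<open>The index bounds would be unsatisfiable for \<open>k = 0\<close>.\<close>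
  have "k > 0" using assms by (cases k) auto
  then show ?thesis using assms by (simp add: kronecker_def all_ones_mat_def)
qed

text \<open>The entry depends only on the blocks of \<open>r\<close> and \<open>c\<close>. It is
  kept as a sum of two indicators, both firing when \<open>n = 1\<close>, to match
  \<open>prod_two_indicators\<close>.\<close>

lemma index_circulant_kronecker:
  fixes a0 a1 :: "'a::comm_ring_1"
  assumes "r < n * k" "c < n * k"
  shows "kronecker (a0 \<cdot>\<^sub>m 1\<^sub>m n + a1 \<cdot>\<^sub>m cyclic_shift_mat n) (all_ones_mat k) $$ (r, c) =
    (if r div k = c div k then a0 else 0) + (if r div k = (c div k + n - 1) mod n then a1 else 0)"
proof -
  have "r div k < n" "c div k < n" using assms by (simp_all add: less_mult_imp_div_less)
  with assms show ?thesis
    by (simp add: index_kronecker_all_ones cyclic_shift_mat_def cong_diff_one_iff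
        pred_mod_eq_iff[of "r div k" n "c div k"] del: One_nat_def)
qed

lemma card_block:
  fixes i k n :: nat
  assumes "i < n"
  shows "card {v \<in> {0..<n * k}. v div k = i} = k"
proof (cases "k = 0")
  case False
  have lt: "v < n * k" if "v < i * k + k" for v
  proof -
    have "i * k + k \<le> n * k" using assms mult_le_mono1[of "Suc i" n k] by simp
    then show ?thesis using that by simp
  qed
  have eq: "v div k = i \<longleftrightarrow> i * k \<le> v \<and> v < i * k + k" for v
  proof
    show "v div k = i" if "i * k \<le> v \<and> v < i * k + k"
      using that by (intro div_nat_eqI) (simp_all only: mult_Suc mult.commute[of k] add.commute[of k])
    show "i * k \<le> v \<and> v < i * k + k" if "v div k = i"
      unfolding that[symmetric]
      using dividend_less_div_times[of k v] div_times_less_eq_dividend[of v k] False by linarith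
  qed
  have "{v \<in> {0..<n * k}. v div k = i} = {i * k..<i * k + k}"
    unfolding eq using lt by fastforce
  then show ?thesis by simp
qed simp


text \<open>Each row block has \<open>k\<close> rows, so the columns sent to block \<open>i\<close>
  contribute an independent count of injections into a set of size \<open>k\<close>.\<close>

lemma card_block_injections:
  fixes n k :: nat and b :: "nat \<Rightarrow> nat"
  assumes "finite U" and b: "b ` U \<subseteq> {0..<n}"
  shows "card {\<tau> \<in> {\<tau>. \<tau> \<in> U \<rightarrow>\<^sub>E {0..<n * k} \<and> inj_on \<tau> U}. \<forall>j\<in>U. \<tau> j div k = b j} =
    (\<Prod>i = 0..<n. (k choose card {j \<in> U. b j = i}) * fact (card {j \<in> U. b j = i}))"
proof -
  have "{\<tau> \<in> {\<tau>. \<tau> \<in> U \<rightarrow>\<^sub>E {0..<n * k} \<and> inj_on \<tau> U}. \<forall>j\<in>U. \<tau> j div k = b j} =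
    {\<tau> \<in> U \<rightarrow>\<^sub>E {0..<n * k}. inj_on \<tau> U \<and> (\<forall>j\<in>U. \<tau> j div k = b j)}"
    by auto
  moreover have "card {f \<in> {x \<in> U. b x = i} \<rightarrow>\<^sub>E {y \<in> {0..<n * k}. y div k = i}. inj_on f {x \<in> U. b x = i}} =
      (k choose card {j \<in> U. b j = i}) * fact (card {j \<in> U. b j = i})" if "i \<in> {0..<n}" for i
    using that \<open>finite U\<close> card_block[of i n k] by (subst card_injections) auto
  ultimately show ?thesis
    using card_fibrewise_injections[OF finite_atLeastLessThan b, where g = "\<lambda>y. y div k"]
    by simp
qed

lemma sum_fibre_cards:
  assumes "finite A" "b ` A \<subseteq> {0..<n::nat}"
  shows "(\<Sum>i = 0..<n. card {x \<in> A. b x = i}) = card A"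
  using sum.group[of A "{0..<n}" b "\<lambda>_. 1::nat"] assms by simp

theorem theorem33:
  fixes a0 a1 :: "'a::comm_ring_1" and n k :: nat
  assumes "n \<ge> 1" and "k \<ge> 1"
  shows "rook_poly (kronecker (a0 \<cdot>\<^sub>m 1\<^sub>m n + a1 \<cdot>\<^sub>m cyclic_shift_mat n) (all_ones_mat k)) =
    (\<Sum>(l1, l2) | l1 \<in> {0..<n} \<rightarrow>\<^sub>E {0..k} \<and> l2 \<in> {0..<n} \<rightarrow>\<^sub>E {0..k} \<and>
        (\<forall>i<n. l2 i \<le> min (k - l1 i) (k - l1 ((i + 1) mod n))).
      monom
        (of_nat (\<Prod>i = 0..<n. (k choose l1 i) * ((k - l1 ((i + 1) mod n)) choose l2 i) *
             (k choose (l1 i + l2 i)) * fact (l1 i + l2 i)) *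
          a0 ^ (\<Sum>i = 0..<n. l1 i) * a1 ^ (\<Sum>i = 0..<n. l2 i))
        (\<Sum>i = 0..<n. l1 i + l2 i))"
proof -

  \<comment> \<open>Column sets and their count vectors\<close>
  define K where "K = kronecker (a0 \<cdot>\<^sub>m 1\<^sub>m n + a1 \<cdot>\<^sub>m cyclic_shift_mat n) (all_ones_mat k)"
  define B where "B = {0..<n * k}"
  \<comment> \<open>\<open>same j\<close> and \<open>prev j\<close> are the row blocks that meet
    column \<open>j\<close> in an \<open>a0\<close> entry and in an \<open>a1\<close> entry.\<close>
  define same where "same j = j div k" for j
  define prev where "prev j = (j div k + n - 1) mod n" for j
  \<comment> \<open>\<open>c C\<close> and \<open>d D\<close> will play the roles of
    \<open>l1\<close> and \<open>l2\<close>; they are restricted to \<open>{0..<n}\<close> to lie in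
    the extensional index set.\<close>
  define c where "c C = (\<lambda>i\<in>{0..<n}. card {j \<in> C. same j = i})" for C
  define d where "d D = (\<lambda>i\<in>{0..<n}. card {j \<in> D. prev j = i})" for D
  \<comment> \<open>For given count vectors, \<open>w\<close> counts the row assignments for one
    pair \<open>(C, D)\<close>, and \<open>N\<close> below counts the pairs. The argument
    \<open>m\<close> of \<open>contrib\<close> is a multiplicity.\<close>
  define w where "w l1 l2 = (\<Prod>i = 0..<n. (k choose (l1 i + l2 i)) * fact (l1 i + l2 i))"
    for l1 l2 :: "nat \<Rightarrow> nat"
  define contrib where "contrib l1 l2 m = monom (of_nat (w l1 l2 * m) *
      a0 ^ (\<Sum>i = 0..<n. l1 i) * a1 ^ (\<Sum>i = 0..<n. l2 i)) (\<Sum>i = 0..<n. l1 i + l2 i)"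
    for l1 l2 :: "nat \<Rightarrow> nat" and m
  define N where "N l1 l2 = (\<Prod>i = 0..<n. (k choose l1 i) * ((k - l1 ((i + 1) mod n)) choose l2 i))"
    for l1 l2 :: "nat \<Rightarrow> nat"
  have finB: "finite B" by (simp add: B_def)
  have fin_sub: "finite X" if "X \<subseteq> B" for X using that finB by (rule finite_subset)
  have block: "j div k < n" if "j \<in> B" for j using that by (simp add: B_def less_mult_imp_div_less)
  have same_img: "same ` X \<subseteq> {0..<n}" if "X \<subseteq> B" for X using that block by (auto simp: same_def)
  have prev_img: "prev ` X \<subseteq> {0..<n}" for X using assms(1) by (auto simp: prev_def)
  have prev_iff: "prev j = i \<longleftrightarrow> j div k = (i + 1) mod n" if "i < n" "j \<in> B" for i j
    using pred_mod_eq_iff[OF that(1) block[OF that(2)]] by (auto simp: prev_def)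
  have dims: "dim_row K = n * k" "dim_col K = n * k"
    by (simp_all add: K_def kronecker_def all_ones_mat_def cyclic_shift_mat_def)
  have entry: "K $$ (r, j) = (if r div k = same j then a0 else 0) + (if r div k = prev j then a1 else 0)"
    if "r \<in> B" "j \<in> B" for r j
    using that unfolding K_def same_def prev_def B_def by (intro index_circulant_kronecker) auto
  let ?inj = "\<lambda>U. {\<tau>. \<tau> \<in> U \<rightarrow>\<^sub>E B \<and> inj_on \<tau> U}"

  \<comment> \<open>With \<open>U\<close> and \<open>C\<close> fixed, all compatible
    \<open>\<tau>\<close> carry the same monomial and there are \<open>w\<close> of them, so the
    total depends on \<open>C\<close> and \<open>U - C\<close> only through their count
    vectors.\<close>
  have weight: "(\<Sum>\<tau>\<in>?inj U. monom (if \<forall>j\<in>U. \<tau> j div k = (if j \<in> C then same j else prev j)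
        then a0 ^ card C * a1 ^ card (U - C) else 0) (card U)) = contrib (c C) (d (U - C)) 1"
    if U: "U \<subseteq> B" and C: "C \<subseteq> U" for U C
  proof -
    let ?b = "\<lambda>j. if j \<in> C then same j else prev j"
    let ?Q = "\<lambda>\<tau>. \<forall>j\<in>U. \<tau> j div k = ?b j"
    have finU: "finite U" "finite C" "finite (U - C)"
      using fin_sub[OF U] C by (auto intro: finite_subset)
    have b_img: "?b ` U \<subseteq> {0..<n}" using same_img[OF U] prev_img[of U] by auto
    have "card {j \<in> U. ?b j = i} = c C i + d (U - C) i" if "i < n" for i
    proof -
      have "{j \<in> U. ?b j = i} = {j \<in> C. same j = i} \<union> {j \<in> U - C. prev j = i}"
        using C by auto
      also have "card \<dots> = card {j \<in> C. same j = i} + card {j \<in> U - C. prev j = i}"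
        using finU by (intro card_Un_disjoint) auto
      finally show ?thesis using that by (simp add: c_def d_def)
    qed
    then have "card {\<tau> \<in> ?inj U. ?Q \<tau>} = w (c C) (d (U - C))"
      unfolding w_def B_def using card_block_injections[OF finU(1) b_img, of k] by simp
    moreover have "(\<Sum>i = 0..<n. c C i) = card C"
      using sum_fibre_cards[of C same n] finU same_img[of C] U C by (simp add: c_def)
    moreover have "(\<Sum>i = 0..<n. d (U - C) i) = card (U - C)"
      using sum_fibre_cards[of "U - C" prev n] finU prev_img[of "U - C"] by (simp add: d_def)
    moreover have "card U = card C + card (U - C)"
      using card_Un_disjoint[of C "U - C"] finU C by (simp add: Un_absorb1)
    moreover have "(\<Sum>\<tau>\<in>?inj U. monom (if ?Q \<tau> then a0 ^ card C * a1 ^ card (U - C) else 0) (card U)) =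
      (\<Sum>\<tau> | \<tau> \<in> ?inj U \<and> ?Q \<tau>. monom (a0 ^ card C * a1 ^ card (U - C)) (card U))"
      using finite_injections[OF finU(1) finB]
      by (intro sum.mono_neutral_cong_right) auto
    ultimately show ?thesis
      by (simp add: contrib_def sum.distrib of_nat_poly mult_monom smult_monom mult.assoc flip: monom_sum)
  qed

  \<comment> \<open>Summing over pairs of disjoint column sets\<close>
  have "rook_poly K = (\<Sum>U\<in>Pow B. \<Sum>\<tau>\<in>?inj U. monom (\<Prod>j\<in>U. K $$ (\<tau> j, j)) (card U))"
    unfolding rook_poly_eq_sum_columns dims B_def ..
  also have "\<dots> = (\<Sum>U\<in>Pow B. \<Sum>\<tau>\<in>?inj U. \<Sum>C\<in>Pow U.
      monom (if \<forall>j\<in>U. \<tau> j div k = (if j \<in> C then same j else prev j)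
        then a0 ^ card C * a1 ^ card (U - C) else 0) (card U))"
  proof (intro sum.cong refl)
    fix U \<tau> assume U: "U \<in> Pow B" and \<tau>: "\<tau> \<in> ?inj U"
    then have "(\<Prod>j\<in>U. K $$ (\<tau> j, j)) = (\<Prod>j\<in>U. (if \<tau> j div k = same j then a0 else 0) +
        (if \<tau> j div k = prev j then a1 else 0))"
      by (intro prod.cong refl entry) auto
    then show "monom (\<Prod>j\<in>U. K $$ (\<tau> j, j)) (card U) = (\<Sum>C\<in>Pow U.
      monom (if \<forall>j\<in>U. \<tau> j div k = (if j \<in> C then same j else prev j)
        then a0 ^ card C * a1 ^ card (U - C) else 0) (card U))"
      using U fin_sub by (simp only: prod_two_indicators monom_sum Pow_iff)
  qed
  also have "\<dots> = (\<Sum>U\<in>Pow B. \<Sum>C\<in>Pow U. contrib (c C) (d (U - C)) 1)"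
  proof (rule sum.cong[OF refl])
    fix U assume "U \<in> Pow B"
    then show "(\<Sum>\<tau>\<in>?inj U. \<Sum>C\<in>Pow U.
      monom (if \<forall>j\<in>U. \<tau> j div k = (if j \<in> C then same j else prev j)
        then a0 ^ card C * a1 ^ card (U - C) else 0) (card U)) = (\<Sum>C\<in>Pow U. contrib (c C) (d (U - C)) 1)"
      by (subst sum.swap) (intro sum.cong refl weight; simp)
  qed
  also have "\<dots> = (\<Sum>C\<in>Pow B. \<Sum>D\<in>Pow (B - C). contrib (c C) (d D) 1)"
    by (rule sum_Pow_split[OF finB])
  also have "\<dots> = (\<Sum>(C, D)\<in>Sigma (Pow B) (\<lambda>C. Pow (B - C)). contrib (c C) (d D) 1)"
    using finB by (subst sum.Sigma) auto
  finally have rook: "rook_poly K = \<dots>" .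

  \<comment> \<open>Counting the pairs with given count vectors\<close>
  define S where "S = Sigma (Pow B) (\<lambda>C. Pow (B - C))"
  define T where "T = ({0..<n} \<rightarrow>\<^sub>E {0..k}) \<times> ({0..<n} \<rightarrow>\<^sub>E {0..k})"
  have block_card: "card {j \<in> B. same j = i} = k" if "i < n" for i
    using card_block[OF that] by (simp add: B_def same_def)
  have block_card': "card {j \<in> B. prev j = i} = k" if "i < n" for i
  proof -
    \<comment> \<open>The columns reached from row block \<open>i\<close> through \<open>a1\<close>
      form the cyclically next column block.\<close>
    have "{j \<in> B. prev j = i} = {j \<in> B. same j = (i + 1) mod n}"
      using prev_iff[OF that] by (auto simp: same_def)
    then show ?thesis using block_card[of "(i + 1) mod n"] assms(1) by simp
  qed
  have finS: "finite S" unfolding S_def using finB by (intro finite_SigmaI) auto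
  have finT: "finite T" unfolding T_def by (intro finite_cartesian_product finite_PiE) auto
  have fibre_card_le: "card {j \<in> X. b j = i} \<le> k"
    if "X \<subseteq> B" "card {j \<in> B. b j = i} = k" for X i and b :: "nat \<Rightarrow> nat"
  proof -
    have "card {j \<in> X. b j = i} \<le> card {j \<in> B. b j = i}"
      by (rule card_mono) (use finB that(1) in auto)
    then show ?thesis using that(2) by simp
  qed
  have c_mem: "c C \<in> {0..<n} \<rightarrow>\<^sub>E {0..k}" if "C \<subseteq> B" for C
    unfolding c_def by (simp add: fibre_card_le that block_card)
  have d_mem: "d D \<in> {0..<n} \<rightarrow>\<^sub>E {0..k}" if "D \<subseteq> B" for D
    unfolding d_def by (simp add: fibre_card_le that block_card')
  have count: "card {p \<in> S. (\<lambda>(C, D). (c C, d D)) p = (l1, l2)} = N l1 l2" if "(l1, l2) \<in> T" for l1 l2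
  proof -
    have l: "l1 \<in> {0..<n} \<rightarrow>\<^sub>E {0..k}" "l2 \<in> {0..<n} \<rightarrow>\<^sub>E {0..k}" using that by (auto simp: T_def)
    have c_eq: "c C = l1 \<longleftrightarrow> (\<forall>i\<in>{0..<n}. card {j \<in> C. same j = i} = l1 i)" for C
      using PiE_arb[OF l(1)] by (auto simp: c_def fun_eq_iff)
    have d_eq: "d D = l2 \<longleftrightarrow> (\<forall>i\<in>{0..<n}. card {j \<in> D. prev j = i} = l2 i)" for D
      using PiE_arb[OF l(2)] by (auto simp: d_def fun_eq_iff)
    have D_count: "card {D \<in> Pow (B - C). d D = l2} =
        (\<Prod>i = 0..<n. (k - l1 ((i + 1) mod n)) choose l2 i)" if C: "C \<subseteq> B" "c C = l1" for C
    proof -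
      have "card {j \<in> B - C. prev j = i} = k - l1 ((i + 1) mod n)" if "i < n" for i
      proof -
        let ?i = "(i + 1) mod n"
        have i': "?i < n" using assms(1) by simp
        \<comment> \<open>\<open>D\<close> draws from column block \<open>i + 1\<close> after
          \<open>C\<close> has removed \<open>l1 (i + 1)\<close> of its columns, indices being
          cyclic. This is the source of the shifted index in the formula.\<close>
        have "{j \<in> B - C. prev j = i} = {j \<in> B. same j = ?i} - {j \<in> C. same j = ?i}"
          using prev_iff[OF that] C(1) by (auto simp: same_def)
        also have "card \<dots> = k - card {j \<in> C. same j = ?i}"
          using C(1) block_card[OF i'] fin_sub[OF C(1)] by (subst card_Diff_subset) auto
        also have "card {j \<in> C. same j = ?i} = l1 ?i" using C(2) i' by (simp add: c_eq)
        finally show ?thesis .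
      qed
      then show ?thesis
        unfolding d_eq using finB prev_img[of "B - C"]
        by (subst card_subsets_with_fibre_cards) auto
    qed
    have "{p \<in> S. (\<lambda>(C, D). (c C, d D)) p = (l1, l2)} =
        Sigma {C \<in> Pow B. c C = l1} (\<lambda>C. {D \<in> Pow (B - C). d D = l2})"
      by (auto simp: S_def)
    also have "card \<dots> = (\<Sum>C\<in>{C \<in> Pow B. c C = l1}. card {D \<in> Pow (B - C). d D = l2})"
      using finB by (intro card_SigmaI) auto
    \<comment> \<open>The number of admissible \<open>D\<close> is the same for every
      \<open>C\<close> with counts \<open>l1\<close>, so the sum becomes a product.\<close>
    also have "\<dots> = card {C \<in> Pow B. c C = l1} * (\<Prod>i = 0..<n. (k - l1 ((i + 1) mod n)) choose l2 i)"
      using D_count by simp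
    also have "card {C \<in> Pow B. c C = l1} = (\<Prod>i = 0..<n. k choose l1 i)"
      unfolding c_eq using finB same_img[of B] block_card
      by (subst card_subsets_with_fibre_cards) auto
    finally show ?thesis by (simp add: N_def prod.distrib)
  qed

  \<comment> \<open>Grouping by count vectors and trimming the index set\<close>
  have "rook_poly K = (\<Sum>(C, D)\<in>S. contrib (c C) (d D) 1)"
    using rook by (simp only: S_def)
  also have "\<dots> = (\<Sum>q\<in>T. \<Sum>p | p \<in> S \<and> (\<lambda>(C, D). (c C, d D)) p = q. (\<lambda>(C, D). contrib (c C) (d D) 1) p)"
    \<comment> \<open>\<open>T\<close> imposes only the bound \<open>k\<close> on the counts, which
      makes membership immediate; the finer constraints are restored afterwards.\<close>
    by (rule sum.group[symmetric, OF finS finT]) (auto simp: S_def T_def intro!: c_mem d_mem)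
  also have "\<dots> = (\<Sum>(l1, l2)\<in>T. contrib l1 l2 (N l1 l2))"
  proof (rule sum.cong[OF refl])
    fix q assume q: "q \<in> T"
    obtain l1 l2 where l: "q = (l1, l2)" by force
    let ?X = "{p. p \<in> S \<and> (\<lambda>(C, D). (c C, d D)) p = q}"
    have "(\<Sum>p\<in>?X. (\<lambda>(C, D). contrib (c C) (d D) 1) p) = (\<Sum>p\<in>?X. contrib l1 l2 1)"
      by (intro sum.cong refl) (auto simp: l)
    also have "\<dots> = of_nat (N l1 l2) * contrib l1 l2 1"
      using count q by (simp add: l)
    also have "\<dots> = contrib l1 l2 (N l1 l2)"
      by (simp add: contrib_def of_nat_poly smult_monom ac_simps)
    finally show "(\<Sum>p\<in>?X. (\<lambda>(C, D). contrib (c C) (d D) 1) p) = (\<lambda>(l1, l2). contrib l1 l2 (N l1 l2)) q"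
      by (simp add: l)
  qed
  also have "\<dots> = (\<Sum>(l1, l2) | l1 \<in> {0..<n} \<rightarrow>\<^sub>E {0..k} \<and> l2 \<in> {0..<n} \<rightarrow>\<^sub>E {0..k} \<and>
        (\<forall>i<n. l2 i \<le> min (k - l1 i) (k - l1 ((i + 1) mod n))). contrib l1 l2 (N l1 l2))"
    (is "_ = sum _ ?L")
  proof (rule sum.mono_neutral_right[OF finT])
    \<comment> \<open>Outside the index set of the theorem one of the binomial coefficients vanishes.\<close>
    show "?L \<subseteq> T" by (auto simp: T_def)
    show "\<forall>q\<in>T - ?L. (\<lambda>(l1, l2). contrib l1 l2 (N l1 l2)) q = 0"
    proof
      fix q assume q: "q \<in> T - ?L"
      obtain l1 l2 where l: "q = (l1, l2)" by force
      with q obtain i where i: "i < n" "\<not> l2 i \<le> min (k - l1 i) (k - l1 ((i + 1) mod n))"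
        by (auto simp: T_def)
      \<comment> \<open>In the first case the row coefficient in \<open>w\<close> vanishes, in the
        second the coefficient for choosing \<open>D\<close> in \<open>N\<close>.\<close>
      then consider "l1 i + l2 i > k" | "l2 i > k - l1 ((i + 1) mod n)" by linarith
      then have "w l1 l2 * N l1 l2 = 0"
      proof cases
        case 1
        then have "w l1 l2 = 0" unfolding w_def using i(1)
          by (intro prod_zero) (auto intro!: bexI[of _ i])
        then show ?thesis by simp
      next
        case 2
        then have "N l1 l2 = 0" unfolding N_def using i(1)
          by (intro prod_zero) (auto intro!: bexI[of _ i])
        then show ?thesis by simp
      qed
      then show "(\<lambda>(l1, l2). contrib l1 l2 (N l1 l2)) q = 0" by (simp only: l contrib_def prod.case of_nat_0 mult_zero_left monom_eq_0)
    qed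
  qed
  finally show ?thesis
    by (simp add: K_def contrib_def N_def w_def ac_simps flip: prod.distrib)
qed

end
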